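(* Let $m\in(0,1)$, $0<\epsilon<1$ and $\beta=\epsilon^{m}$, let $\varphi,g\in\mathcal H$ be the exact data with mild solution $u$ on $[0,T]$ of the linear homogeneous Cauchy problem, let $\varphi^\epsilon,g^\epsilon\in\mathcal H$ satisfy $\|\varphi-\varphi^\epsilon\|\le\epsilon$ and $\|g-g^\epsilon\|\le\epsilon$, and let $v^\epsilon$ be the regularized solution built from $\varphi^\epsilon,g^\epsilon$ with parameter $\beta$ (all as defined in the context). (i) If there is a positive constant $E_1$ such that $$\sqrt{\frac{\|u(T)\|^2}{2}+\frac{\|\frac{\partial}{\partial t}u(T)\|^2}{2\lambda_1}}<E_1,$$ then $$\|u(t)-v^\epsilon(t)\|\le\sqrt{2\left(1+\tfrac1{\lambda_1}\right)}\,\epsilon^{1-m}+E_1\epsilon^{m}\quad\text{for } t\in\left[0,\tfrac T2\right],$$ $$\|u(t)-v^\epsilon(t)\|\le\sqrt{2\left(1+\tfrac1{\lambda_1}\right)}\,\epsilon^{1-m}+E_1\epsilon^{\frac{m(T-t)}{t}}\quad\text{for } t\in\left[\tfrac T2,T\right].$$ (ii) If there is a positive constant $E_2$ such that, for $t\in[0,T]$, $$\sqrt{\sum_{p\ge1}e^{2\sqrt{\lambda_p}(T-t)}\left(\sqrt{\lambda_p}\langle u(t),\phi_p\rangle+\left\langle\tfrac{\partial}{\partial t}u(t),\phi_p\right\rangle\right)^2}<E_2,$$ then $$\|u(t)-v^\epsilon(t)\|\le\sqrt{2\left(1+\tfrac1{\lambda_1}\right)}\,\epsilon^{1-m}+\frac{\epsilon^m}{2\sqrt{\lambda_1}}E_2\quad\text{for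 } t\in\left[0,\tfrac T2\right],$$ $$\|u(t)-v^\epsilon(t)\|\le\sqrt{2\left(1+\tfrac1{\lambda_1}\right)}\,\epsilon^{1-m}+\frac{\epsilon^{\frac{m(T-t)}{t}}}{2\sqrt{\lambda_1}}\left[\frac{\lambda_1 T}{1+\ln\left(\frac{\sqrt{\lambda_1}T}{\epsilon^m}\right)}\right]^{\frac{2t-T}{t}}E_2\quad\text{for } t\in\left[\tfrac T2,T\right].$$ (iii) If there is a positive constant $E_3$ such that, for $t\in[0,T]$, $$\sqrt{\sum_{p\ge1}e^{2\sqrt{\lambda_p}t}\left(\left\langle\sqrt{\lambda_p}\,u(t)+\tfrac{\partial}{\partial t}u(t),\phi_p\right\rangle\right)^2}<E_3,$$ then, for $t\in[0,T]$, $$\|u(t)-v^\epsilon(t)\|\le\sqrt{2\left(1+\tfrac1{\lambda_1}\right)}\,\epsilon^{1-m}+E_3\frac{\epsilon^m}{2}.$$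
   Context: $\mathcal H$ is a real Hilbert space with inner product $\langle\cdot,\cdot\rangle$ and norm $\|\cdot\|$; $T>0$. $\mathcal A:\mathcal D(\mathcal A)\subset\mathcal H\to\mathcal H$ is a positive-definite, self-adjoint operator with compact inverse; $\{\phi_p\}_{p\ge1}$ is an orthonormal basis of $\mathcal H$ of eigenvectors, $\mathcal A\phi_p=\lambda_p\phi_p$, with $0<\lambda_1\le\lambda_2\le\dots$ and $\lim_{p\to\infty}\lambda_p=\infty$. The linear homogeneous Cauchy problem is $u''(t)=\mathcal Au(t)$ on $[0,T]$, $u(0)=\varphi$, $u'(0)=g$. Its mild solution, assumed to exist on $[0,T]$, is $$u(t)=\sum_{p\ge1}\left[\cosh(\sqrt{\lambda_p}t)\langle\varphi,\phi_p\rangle+\frac{\sinh(\sqrt{\lambda_p}t)}{\sqrt{\lambda_p}}\langle g,\phi_p\rangle\right]\phi_p,$$ and $\frac{\partial}{\partial t}u(t)$ is its time derivative, with Fourier coefficients $\langle\frac{\partial}{\partial t}u(t),\phi_p\rangle=\frac{d}{dt}\langle u(t),\phi_p\rangle$. The regularized solution with data $\varphi^\epsilon,g^\epsilon$ and parameter $\beta>0$ is $$v^\epsilon(t)=\sum_{p\ge1}\left[\frac{1}{2\beta+2e^{-\sqrt{\lambda_p}t}}\left(\langle\varphi^\epsilon,\phi_p\rangle+\frac{\langle g^\epsilon,\phi_p\rangle}{\sqrt{\lambda_p}}\right)+\frac{e^{-\sqrt{\lambda_p}t}}{2}\left(\langle\varphi^\epsilon,\phi_p\rangle-\frac{\langle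 g^\epsilon,\phi_p\rangle}{\sqrt{\lambda_p}}\right)\right]\phi_p.$$
   Formalization: The second estimate of (ii) is proved only when λ_1 ≥ 1 and 1 + ln(√λ_1 T/ε^m) > 0, and (iii) only when λ_1 ≥ 1; without λ_1 ≥ 1 both fail (e.g. λ_1 = 1/100, T = 10, m = 1/2, ε = 1/4, φ = 1000φ_1, g = 0), and without the log condition the bracket's power is undefined. *)

theory Defs
  imports "HOL-Analysis.Analysis"
begin

text \<open>
  A possibly unbounded operator on a real Hilbert space is a pair of a domain \<open>D\<close> and a total
  function \<open>A\<close> whose values outside \<open>D\<close> are not used.
\<close>

definition linear_operator_on :: "'a::real_vector set \<Rightarrow> ('a \<Rightarrow> 'a) \<Rightarrow> bool" where
  "linear_operator_on D A \<longleftrightarrow>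
     subspace D \<and>
     (\<forall>x\<in>D. \<forall>y\<in>D. A (x + y) = A x + A y) \<and>
     (\<forall>c. \<forall>x\<in>D. A (c *\<^sub>R x) = c *\<^sub>R A x)"

text \<open>
  The last conjunct says that the graph of the adjoint, i.e. the set of all \<open>(y, z)\<close> with
  \<open>\<langle>A x, y\<rangle> = \<langle>x, z\<rangle>\<close> for every \<open>x \<in> D\<close>, is the graph of \<open>A\<close>; in particular the domains agree.
\<close>

definition self_adjoint_operator :: "'a::real_inner set \<Rightarrow> ('a \<Rightarrow> 'a) \<Rightarrow> bool" where
  "self_adjoint_operator D A \<longleftrightarrow>
     linear_operator_on D A \<and>
     closure D = UNIV \<and>
     (\<forall>y z. (\<forall>x\<in>D. inner (A x) y = inner x z) \<longleftrightarrow> (y \<in> D \<and> A y = z))"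

definition positive_definite_operator :: "'a::real_inner set \<Rightarrow> ('a \<Rightarrow> 'a) \<Rightarrow> bool" where
  "positive_definite_operator D A \<longleftrightarrow> (\<forall>x\<in>D. x \<noteq> 0 \<longrightarrow> inner (A x) x > 0)"

definition has_compact_inverse :: "'a::real_normed_vector set \<Rightarrow> ('a \<Rightarrow> 'a) \<Rightarrow> bool" where
  "has_compact_inverse D A \<longleftrightarrow>
     bij_betw A D UNIV \<and>
     (\<forall>S. bounded S \<longrightarrow> compact (closure (inv_into D A ` S)))"

definition orthonormal_basis :: "(nat \<Rightarrow> 'a::real_inner) \<Rightarrow> bool" where
  "orthonormal_basis \<phi> \<longleftrightarrow>
     (\<forall>p q. inner (\<phi> p) (\<phi> q) = (if p = q then 1 else 0)) \<and>
     closure (span (range \<phi>)) = UNIV"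

text \<open>
  Modes are numbered from \<open>0\<close>, so that \<open>lam 0\<close> is the smallest eigenvalue.
\<close>

definition eigenbasis ::
  "'a::real_inner set \<Rightarrow> ('a \<Rightarrow> 'a) \<Rightarrow> (nat \<Rightarrow> 'a) \<Rightarrow> (nat \<Rightarrow> real) \<Rightarrow> bool" where
  "eigenbasis D A \<phi> lam \<longleftrightarrow>
     orthonormal_basis \<phi> \<and>
     (\<forall>p. \<phi> p \<in> D \<and> A (\<phi> p) = lam p *\<^sub>R \<phi> p) \<and>
     0 < lam 0 \<and> mono lam \<and> filterlim lam at_top sequentially"

text \<open>
  The mild solution of \<open>u'' = A u\<close>, \<open>u 0 = f\<close>, \<open>u' 0 = g\<close>. As the series need not converge, its
  convergence at every time in \<open>[0, T]\<close> is part of the predicate.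
\<close>

definition mild_solution ::
  "(nat \<Rightarrow> 'a::real_inner) \<Rightarrow> (nat \<Rightarrow> real) \<Rightarrow> real \<Rightarrow> 'a \<Rightarrow> 'a \<Rightarrow> (real \<Rightarrow> 'a) \<Rightarrow> bool" where
  "mild_solution \<phi> lam T f g u \<longleftrightarrow>
     (\<forall>t\<in>{0..T}.
        (\<lambda>p. (cosh (sqrt (lam p) * t) * inner f (\<phi> p)
              + sinh (sqrt (lam p) * t) / sqrt (lam p) * inner g (\<phi> p)) *\<^sub>R \<phi> p) sums u t)"

definition regularized_solution ::
  "(nat \<Rightarrow> 'a::real_inner) \<Rightarrow> (nat \<Rightarrow> real) \<Rightarrow> real \<Rightarrow> 'a \<Rightarrow> 'a \<Rightarrow> real \<Rightarrow> 'a" where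
  "regularized_solution \<phi> lam \<beta> f g t =
     (\<Sum>p. (1 / (2 * \<beta> + 2 * exp (- (sqrt (lam p) * t)))
              * (inner f (\<phi> p) + inner g (\<phi> p) / sqrt (lam p))
            + exp (- (sqrt (lam p) * t)) / 2
              * (inner f (\<phi> p) - inner g (\<phi> p) / sqrt (lam p))) *\<^sub>R \<phi> p)"

end

theory Submission
  imports Defs
begin

text \<open>
  Write \<open>s = sqrt (lam p)\<close> and \<open>a = \<langle>f, \<phi> p\<rangle> + \<langle>g, \<phi> p\<rangle> / s\<close>. Regularizing the exact data damps only the
  growing part of each mode, so the \<open>p\<close>-th coefficient of \<open>u t\<close> changes by
  \<open>a / 2 * exp (s * t) * k\<close> with \<open>k = \<beta> / (\<beta> + exp (- s * t))\<close>. On the other hand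
  \<open>s * \<langle>u t, \<phi> p\<rangle> + \<langle>u' t, \<phi> p\<rangle> = s * a * exp (s * t)\<close>, so each a priori bound controls a weighted
  \<open>l\<^sup>2\<close> norm of \<open>a\<close>, and it remains to bound \<open>exp (- s * (T - t)) * k\<close> uniformly in \<open>s\<close>. For
  \<open>t \<ge> T / 2\<close> this is an interpolation between \<open>k * exp (- s * t) \<le> \<beta>\<close> and \<open>k \<le> 1\<close>, with exponent
  \<open>(T - t) / t\<close>. The noise is amplified by at most \<open>1 / \<beta>\<close>, since all multipliers of the regularized
  problem are bounded by \<open>1 / (2 * \<beta>)\<close>.
\<close>

section \<open>Series along an orthonormal sequence in a Hilbert space\<close>

locale orthonormal_sequence =
  fixes \<phi> :: "nat \<Rightarrow> 'a::{real_inner, complete_space}"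
  assumes inner_basis: "inner (\<phi> p) (\<phi> q) = (if p = q then 1 else 0)"
begin

lemma norm_sum_squared:
  assumes "finite I"
  shows "(norm (\<Sum>p\<in>I. c p *\<^sub>R \<phi> p))\<^sup>2 = (\<Sum>p\<in>I. (c p)\<^sup>2)"
proof -
  have "inner (\<Sum>p\<in>I. c p *\<^sub>R \<phi> p) (\<Sum>p\<in>I. c p *\<^sub>R \<phi> p) = (\<Sum>p\<in>I. (c p)\<^sup>2)"
    using assms
    by (simp add: inner_sum_left inner_sum_right inner_basis if_distrib power2_eq_square
        cong: if_cong)
  then show ?thesis by (simp only: power2_norm_eq_inner)
qed

text \<open>By Pythagoras, the squared distance of two partial sums equals the distance of the
  matching partial sums of the squared coefficients. The Cauchy property therefore passes from the
  scalar series to the vector series, and completeness gives the limit.\<close>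

lemma summable_basis_series:
  assumes "summable (\<lambda>p. (c p)\<^sup>2)"
  shows "summable (\<lambda>p. c p *\<^sub>R \<phi> p)"
proof -
  let ?S = "\<lambda>n. \<Sum>p<n. c p *\<^sub>R \<phi> p" and ?C = "\<lambda>n. \<Sum>p<n. (c p)\<^sup>2"
  have le: "(dist (?S i) (?S j))\<^sup>2 = dist (?C i) (?C j)" if "i \<le> j" for i j
  proof -
    have "?S j - ?S i = (\<Sum>p\<in>{i..<j}. c p *\<^sub>R \<phi> p)" "?C j - ?C i = (\<Sum>p\<in>{i..<j}. (c p)\<^sup>2)"
      using that by (simp_all add: sum_diff_nat_ivl lessThan_atLeast0)
    then have "(norm (?S j - ?S i))\<^sup>2 = norm (?C j - ?C i)"
      by (simp add: norm_sum_squared sum_nonneg)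
    then show ?thesis by (simp only: dist_norm norm_minus_commute)
  qed
  have eq: "(dist (?S i) (?S j))\<^sup>2 = dist (?C i) (?C j)" for i j
    by (cases "i \<le> j") (use le[of i j] le[of j i] in \<open>simp_all add: dist_commute\<close>)
  have "Cauchy ?C"
    using assms by (simp add: summable_iff_convergent convergent_Cauchy)
  have "Cauchy ?S"
  proof (rule metric_CauchyI)
    fix e :: real assume "0 < e"
    then obtain M where "\<And>i j. i \<ge> M \<Longrightarrow> j \<ge> M \<Longrightarrow> dist (?C i) (?C j) < e\<^sup>2"
      using metric_CauchyD[OF \<open>Cauchy ?C\<close>, of "e\<^sup>2"] by auto
    then show "\<exists>M. \<forall>i\<ge>M. \<forall>j\<ge>M. dist (?S i) (?S j) < e"
      using \<open>0 < e\<close> by (intro exI[of _ M]) (auto simp flip: eq intro: power2_less_imp_less)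
  qed
  then show ?thesis
    by (simp add: summable_iff_convergent Cauchy_convergent)
qed

lemma basis_series_coeff:
  assumes "(\<lambda>p. c p *\<^sub>R \<phi> p) sums x"
  shows "inner x (\<phi> q) = c q"
proof -
  have "(\<lambda>p. inner (c p *\<^sub>R \<phi> p) (\<phi> q)) sums inner x (\<phi> q)"
    by (rule bounded_linear.sums[OF bounded_linear_inner_left assms])
  moreover have "(\<lambda>p. inner (c p *\<^sub>R \<phi> p) (\<phi> q)) sums (\<Sum>p\<in>{q}. inner (c p *\<^sub>R \<phi> p) (\<phi> q))"
    by (rule sums_finite) (auto simp: inner_basis)
  ultimately show ?thesis
    using sums_unique2 by (fastforce simp: inner_basis)
qed

text \<open>Pythagoras bounds every partial sum, and continuity of the norm carries the bound to the
  limit. Both halves of the error are estimated this way, with \<open>d\<close> as a modewise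
  majorant.\<close>

lemma norm_basis_series_le:
  assumes sums: "(\<lambda>p. c p *\<^sub>R \<phi> p) sums x" and "summable d"
    and le: "\<And>p. (c p)\<^sup>2 \<le> d p"
  shows "(norm x)\<^sup>2 \<le> suminf d"
proof (rule LIMSEQ_le_const2)
  show "(\<lambda>n. (norm (\<Sum>p<n. c p *\<^sub>R \<phi> p))\<^sup>2) \<longlonglongrightarrow> (norm x)\<^sup>2"
    using sums unfolding sums_def by (intro tendsto_intros)
  have "0 \<le> d p" for p
    using le[of p] by (meson order_trans zero_le_power2)
  then have "(\<Sum>p<n. (c p)\<^sup>2) \<le> suminf d" for n
    by (meson assms(2) finite_lessThan le order_trans sum_le_suminf sum_mono)
  then show "\<exists>N. \<forall>n\<ge>N. (norm (\<Sum>p<n. c p *\<^sub>R \<phi> p))\<^sup>2 \<le> suminf d"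
    by (simp add: norm_sum_squared)
qed

text \<open>Expand the nonnegative squared distance from \<open>x\<close> to its projection
  \<open>?y\<close> onto the first \<open>n\<close> modes.\<close>

lemma bessel_finite: "(\<Sum>p<n. (inner x (\<phi> p))\<^sup>2) \<le> (norm x)\<^sup>2"
proof -
  let ?y = "\<Sum>p<n. inner x (\<phi> p) *\<^sub>R \<phi> p"
  have "inner x ?y = (\<Sum>p<n. (inner x (\<phi> p))\<^sup>2)"
    by (simp add: inner_sum_right power2_eq_square)
  moreover have "(norm ?y)\<^sup>2 = (\<Sum>p<n. (inner x (\<phi> p))\<^sup>2)"
    by (simp add: norm_sum_squared)
  moreover have "0 \<le> (norm (x - ?y))\<^sup>2" by simp
  ultimately show ?thesis
    by (simp add: power2_norm_eq_inner inner_diff_left inner_diff_right inner_commute)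
qed

lemma bessel:
  shows summable_coeff_squared: "summable (\<lambda>p. (inner x (\<phi> p))\<^sup>2)"
    and suminf_coeff_squared_le: "(\<Sum>p. (inner x (\<phi> p))\<^sup>2) \<le> (norm x)\<^sup>2"
proof -
  show s: "summable (\<lambda>p. (inner x (\<phi> p))\<^sup>2)"
    by (rule summableI_nonneg_bounded[OF _ bessel_finite]) simp
  show "(\<Sum>p. (inner x (\<phi> p))\<^sup>2) \<le> (norm x)\<^sup>2"
    by (rule suminf_le_const[OF s bessel_finite])
qed

end

section \<open>Scalar estimates for a single mode\<close>

lemma parallelogram_bound:
  fixes a b k l x y :: real
  assumes "\<bar>k\<bar> \<le> c" "\<bar>l\<bar> \<le> c"
  shows "(k * (x + y) + l * (x - y))\<^sup>2 \<le> (2 * c)\<^sup>2 * (x\<^sup>2 + y\<^sup>2)"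
proof -
  have c: "0 \<le> c" using assms by linarith
  have "\<bar>k * (x + y) + l * (x - y)\<bar> \<le> c * \<bar>x + y\<bar> + c * \<bar>x - y\<bar>"
    by (rule order_trans[OF abs_triangle_ineq])
      (auto simp: abs_mult intro!: add_mono mult_right_mono assms)
  also have "\<dots> = c * (\<bar>x + y\<bar> + \<bar>x - y\<bar>)"
    by (simp add: distrib_left)
  \<comment> \<open>The larger of the two absolute values has its square below x^2 + y^2, so no
    cross term survives.\<close>
  also have "\<bar>x + y\<bar> + \<bar>x - y\<bar> = 2 * max \<bar>x\<bar> \<bar>y\<bar>"
    by linarith
  finally have "(k * (x + y) + l * (x - y))\<^sup>2 \<le> (2 * c * max \<bar>x\<bar> \<bar>y\<bar>)\<^sup>2"
    by (intro power2_le_iff_abs_le[THEN iffD2]) (use c in \<open>auto simp: le_max_iff_disj\<close>)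
  also have "\<dots> = (2 * c)\<^sup>2 * (max \<bar>x\<bar> \<bar>y\<bar>)\<^sup>2"
    by (rule power_mult_distrib)
  also have "\<dots> \<le> (2 * c)\<^sup>2 * (x\<^sup>2 + y\<^sup>2)"
    by (rule mult_left_mono) (auto simp: max_def)
  finally show ?thesis .
qed

text \<open>With k = \<beta> / (\<beta> + x), split k into powers \<theta> and 1 - \<theta>; the
  first joins x^\<theta> to form (x k)^\<theta>, and x k \<le> \<beta>. The second power is kept
  because the logarithmic gain is extracted from it later.\<close>

lemma powr_interpolation_le:
  fixes x \<beta> \<theta> :: real
  assumes "0 < x" "0 < \<beta>" "0 \<le> \<theta>" "\<theta> \<le> 1"
  shows "x powr \<theta> * (\<beta> / (\<beta> + x)) \<le> \<beta> powr \<theta> * (\<beta> / (\<beta> + x)) powr (1 - \<theta>)"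
proof -
  have "x powr \<theta> * (\<beta> / (\<beta> + x)) = x powr \<theta> * ((\<beta> / (\<beta> + x)) powr \<theta> * (\<beta> / (\<beta> + x)) powr (1 - \<theta>))"
    using assms by (simp flip: powr_add)
  also have "\<dots> = (x * \<beta> / (\<beta> + x)) powr \<theta> * (\<beta> / (\<beta> + x)) powr (1 - \<theta>)"
    using assms by (simp add: powr_mult[symmetric] mult.assoc[symmetric])
  also have "\<dots> \<le> \<beta> powr \<theta> * (\<beta> / (\<beta> + x)) powr (1 - \<theta>)"
    using assms by (intro mult_right_mono powr_mono2) (auto simp: field_simps)
  finally show ?thesis .
qed

text \<open>The fraction of the growing exponential removed by the regularization: the multiplier 1
  / (2 \<beta> + 2 exp(-s t)) is exp(s t) / 2 times one minus this quantity.\<close>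

definition filter_error :: "real \<Rightarrow> real \<Rightarrow> real \<Rightarrow> real" where
  "filter_error \<beta> s t = \<beta> / (\<beta> + exp (- (s * t)))"

lemma filter_error_nonneg: "0 < \<beta> \<Longrightarrow> 0 \<le> filter_error \<beta> s t"
  by (simp add: filter_error_def add_nonneg_nonneg)

lemma filter_error_le_1: "0 < \<beta> \<Longrightarrow> filter_error \<beta> s t \<le> 1"
  by (simp add: filter_error_def divide_le_eq_1 add_pos_pos)

lemma filter_error_le_exp:
  assumes "0 < \<beta>"
  shows "filter_error \<beta> s t \<le> \<beta> * exp (s * t)"
proof -
  have "filter_error \<beta> s t \<le> \<beta> / exp (- (s * t))"
    unfolding filter_error_def using assms
    by (intro divide_left_mono mult_pos_pos add_pos_pos) auto
  then show ?thesis by (simp add: exp_minus field_simps)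
qed

text \<open>Bounding the damping by \<beta> exp(s t) leaves the exponent s (2 t - T), which is
  nonpositive in the first half of the interval.\<close>

lemma filter_error_early:
  assumes "0 < \<beta>" "0 \<le> s" "t \<le> T / 2"
  shows "exp (- (s * (T - t))) * filter_error \<beta> s t \<le> \<beta>"
proof -
  have "exp (- (s * (T - t))) * filter_error \<beta> s t \<le> exp (- (s * (T - t))) * (\<beta> * exp (s * t))"
    by (rule mult_left_mono[OF filter_error_le_exp]) (use assms in auto)
  also have "\<dots> = \<beta> * exp (s * (2 * t - T))"
    by (simp add: algebra_simps flip: exp_add)
  also have "\<dots> \<le> \<beta>"
    using assms by (simp add: mult_le_0_iff mult_nonneg_nonpos)
  finally show ?thesis .
qed

text \<open>Interpolation at x = exp(-s t) with \<theta> = (T - t) / t, chosen so that x^\<theta> =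
  exp(-s (T - t)). The constraint \<theta> \<le> 1 is exactly T / 2 \<le> t.\<close>

lemma filter_error_late:
  assumes "0 < \<beta>" "0 < T" "T / 2 \<le> t" "t \<le> T"
  shows "exp (- (s * (T - t))) * filter_error \<beta> s t
    \<le> \<beta> powr ((T - t) / t) * filter_error \<beta> s t powr ((2 * t - T) / t)"
proof -
  have t: "0 < t" using assms by linarith
  have e: "exp (- (s * t)) powr ((T - t) / t) = exp (- (s * (T - t)))"
    using t by (simp add: powr_def)
  have \<theta>: "1 - (T - t) / t = (2 * t - T) / t"
    using t by (simp add: field_simps)
  have "0 \<le> (T - t) / t" "(T - t) / t \<le> 1"
    using assms t by (auto simp: field_simps)
  from powr_interpolation_le[OF exp_gt_zero assms(1) this, of "- (s * t)"]
  show ?thesis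
    by (simp add: e \<theta> filter_error_def)
qed

lemma affine_exp_lower_bound:
  fixes \<gamma> T s :: real
  assumes "0 < \<gamma>" "0 < T"
  shows "\<gamma> / T * (1 + ln (T / \<gamma>)) \<le> \<gamma> * s + exp (- (s * T))"
proof -
  \<comment> \<open>\<open>1 + ln y \<le> y\<close> is sharp at the minimiser of the right-hand side, where \<open>y = 1\<close>\<close>
  define y where "y = exp (- (s * T)) * (T / \<gamma>)"
  have "ln y = - (s * T) + ln (T / \<gamma>)"
    using assms by (simp add: y_def ln_mult del: times_divide_eq_right)
  then have "1 + ln (T / \<gamma>) \<le> s * T + y"
    using ln_le_minus_one[of y] assms by (simp add: y_def)
  then have "\<gamma> / T * (1 + ln (T / \<gamma>)) \<le> \<gamma> / T * (s * T + y)"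
    using assms by (intro mult_left_mono) auto
  also have "\<dots> = \<gamma> * s + exp (- (s * T))"
    using assms by (simp add: y_def field_simps)
  finally show ?thesis .
qed

text \<open>The quotient is \<beta> over \<beta> s + s exp(-s t). Lowering the second
  \<open>s\<close> to \<open>s0\<close> and raising \<open>t\<close> to \<open>T\<close> leaves
  \<open>s0\<close> times the expression of \<open>affine_exp_lower_bound\<close> with \<gamma> =
  \<beta> / s0, whose minimum over \<open>s\<close> produces the logarithm.\<close>

lemma filter_error_log_bound:
  assumes "0 < \<beta>" "0 < T" "t \<le> T" "0 < s0" "s0 \<le> s"
    and L: "0 < 1 + ln (s0 * T / \<beta>)"
  shows "filter_error \<beta> s t / s \<le> T / (1 + ln (s0 * T / \<beta>))"
proof -
  let ?L = "1 + ln (s0 * T / \<beta>)"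
  have s: "0 < s" using assms by linarith
  have "\<beta> * ?L / T \<le> s0 * (\<beta> / s0 * s + exp (- (s * T)))"
    using mult_left_mono[OF affine_exp_lower_bound[of "\<beta> / s0" T s], of s0] assms
    by (simp add: mult.commute)
  also have "\<dots> = \<beta> * s + s0 * exp (- (s * T))"
    using assms by (simp add: field_simps)
  also have "\<dots> \<le> \<beta> * s + s * exp (- (s * t))"
    using assms by (intro add_left_mono mult_mono) auto
  finally have "\<beta> * ?L / T \<le> s * (\<beta> + exp (- (s * t)))"
    by (simp add: algebra_simps)
  then have "\<beta> * ?L / T / ?L \<le> s * (\<beta> + exp (- (s * t))) / ?L"
    by (rule divide_right_mono) (use L in simp)
  then have le: "\<beta> / T \<le> s * (\<beta> + exp (- (s * t))) / ?L" using L by simp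
  have "0 < \<beta> + exp (- (s * t))" using assms by (simp add: add_pos_pos)
  moreover from this have "\<beta> \<le> T / ?L * (s * (\<beta> + exp (- (s * t))))"
    using le assms by (simp add: pos_divide_le_eq mult.commute)
  ultimately show ?thesis
    using s by (simp add: filter_error_def pos_divide_le_eq mult_ac)
qed

text \<open>The power \<eta> = (2 t - T) / t of the damping left over by
  \<open>filter_error_late\<close> is paired with the same power of 1 / s, where the logarithmic
  bound applies. The remaining power 1 - \<eta> of 1 / s is largest at \<open>s0\<close>.\<close>

lemma filter_error_late_log:
  assumes "0 < \<beta>" "0 < T" "T / 2 \<le> t" "t \<le> T" "1 \<le> s0" "s0 \<le> s"
    and L: "0 < 1 + ln (s0 * T / \<beta>)"
  shows "exp (- (s * (T - t))) * filter_error \<beta> s t / s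
    \<le> \<beta> powr ((T - t) / t) / s0 * (s0\<^sup>2 * T / (1 + ln (s0 * T / \<beta>))) powr ((2 * t - T) / t)"
proof -
  define \<eta> where "\<eta> = (2 * t - T) / t"
  let ?k = "filter_error \<beta> s t" and ?L = "1 + ln (s0 * T / \<beta>)"
  have t: "0 < t" and s: "0 < s" using assms by linarith+
  have \<eta>: "0 \<le> \<eta>" "\<eta> \<le> 1" using assms t by (auto simp: \<eta>_def field_simps)
  have k: "0 \<le> ?k" by (rule filter_error_nonneg[OF assms(1)])
  have "?k / s \<le> T / ?L"
    by (rule filter_error_log_bound) (use assms in auto)
  then have "?k powr \<eta> / s powr \<eta> \<le> (T / ?L) powr \<eta>"
    using k s \<eta> by (simp add: powr_mono2 flip: powr_divide)
  moreover have "1 / s powr (1 - \<eta>) \<le> 1 / s0 powr (1 - \<eta>)"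
    using assms \<eta> by (intro divide_left_mono powr_mono2 mult_pos_pos) auto
  ultimately have "?k powr \<eta> / s powr \<eta> * (1 / s powr (1 - \<eta>)) \<le> (T / ?L) powr \<eta> * (1 / s0 powr (1 - \<eta>))"
    by (rule mult_mono) auto
  moreover have "?k powr \<eta> / s powr \<eta> * (1 / s powr (1 - \<eta>)) = ?k powr \<eta> / s"
  proof -
    have "s powr \<eta> * s powr (1 - \<eta>) = s" using s by (simp flip: powr_add)
    then show ?thesis by simp
  qed
  moreover have "1 / s0 powr (1 - \<eta>) = s0 powr \<eta> / s0"
    using assms by (simp add: powr_diff)
  ultimately have "?k powr \<eta> / s \<le> (T / ?L) powr \<eta> * s0 powr \<eta> / s0"
    by (metis times_divide_eq_right)
  also have "\<dots> = (s0 * T / ?L) powr \<eta> / s0"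
    using assms by (simp add: mult.commute flip: powr_mult)
  \<comment> \<open>Here \<open>1 \<le> s0\<close> enlarges \<open>s0\<close> to its square, which
    is the eigenvalue \<open>lam 0\<close> in the application.\<close>
  also have "\<dots> \<le> (s0\<^sup>2 * T / ?L) powr \<eta> / s0"
    using assms \<eta>
    by (intro divide_right_mono powr_mono2 mult_right_mono) (auto simp: power2_eq_square)
  finally have le: "?k powr \<eta> / s \<le> (s0\<^sup>2 * T / ?L) powr \<eta> / s0" .
  have "exp (- (s * (T - t))) * ?k / s \<le> \<beta> powr ((T - t) / t) * ?k powr \<eta> / s"
    using filter_error_late[OF assms(1-4), of s] s by (simp add: divide_right_mono \<eta>_def)
  also have "\<dots> \<le> \<beta> powr ((T - t) / t) * ((s0\<^sup>2 * T / ?L) powr \<eta> / s0)"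
    using le by (simp add: mult_left_mono flip: times_divide_eq_right)
  finally show ?thesis by (simp add: \<eta>_def)
qed

section \<open>Mode coefficients of the mild and regularized solutions\<close>

locale eigen_sequence = orthonormal_sequence \<phi>
  for \<phi> :: "nat \<Rightarrow> 'a::{real_inner, complete_space}" +
  fixes lam :: "nat \<Rightarrow> real"
  assumes lam_0_pos: "0 < lam 0" and mono_lam: "mono lam"
begin

lemma lam_0_le: "lam 0 \<le> lam p"
  using mono_lam by (simp add: monoD)

lemma lam_pos: "0 < lam p"
  using lam_0_pos lam_0_le[of p] by linarith

definition reg_coeff :: "real \<Rightarrow> real \<Rightarrow> 'a \<Rightarrow> 'a \<Rightarrow> nat \<Rightarrow> real" where
  "reg_coeff \<beta> t f g p =
     1 / (2 * \<beta> + 2 * exp (- (sqrt (lam p) * t))) * (inner f (\<phi> p) + inner g (\<phi> p) / sqrt (lam p))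
     + exp (- (sqrt (lam p) * t)) / 2 * (inner f (\<phi> p) - inner g (\<phi> p) / sqrt (lam p))"

text \<open>Twice the amplitude of the growing exponential in mode \<open>p\<close> of the mild
  solution.\<close>

definition growth_coeff :: "'a \<Rightarrow> 'a \<Rightarrow> nat \<Rightarrow> real" where
  "growth_coeff f g p = inner f (\<phi> p) + inner g (\<phi> p) / sqrt (lam p)"

definition mild_coeff :: "real \<Rightarrow> 'a \<Rightarrow> 'a \<Rightarrow> nat \<Rightarrow> real" where
  "mild_coeff t f g p =
     cosh (sqrt (lam p) * t) * inner f (\<phi> p) + sinh (sqrt (lam p) * t) / sqrt (lam p) * inner g (\<phi> p)"

lemma reg_coeff_diff:
  "reg_coeff \<beta> t f g p - reg_coeff \<beta> t f' g' p = reg_coeff \<beta> t (f - f') (g - g') p"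
  by (simp add: reg_coeff_def inner_diff_left diff_divide_distrib add_divide_distrib algebra_simps)

text \<open>Both multipliers are at most 1 / (2 \<beta>): the growing one because its exponential is
  positive, the decaying one because exp(-s t) \<le> 1 \<le> 1 / \<beta>. By Bessel the majorant is
  summable, which yields both convergence and stability.\<close>

lemma reg_coeff_squared_le:
  assumes "0 < \<beta>" "\<beta> \<le> 1" "0 \<le> t"
  shows "(reg_coeff \<beta> t f g p)\<^sup>2 \<le> ((inner f (\<phi> p))\<^sup>2 + (inner g (\<phi> p))\<^sup>2 / lam 0) / \<beta>\<^sup>2"
proof -
  let ?e = "exp (- (sqrt (lam p) * t))"
  have "?e \<le> 1" using assms lam_pos[of p] by simp
  also have "1 \<le> 1 / \<beta>" using assms by simp
  finally have e: "\<bar>?e / 2\<bar> \<le> 1 / (2 * \<beta>)" by simp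
  have "0 < 2 * \<beta> + 2 * ?e" using assms by (intro add_pos_pos) auto
  then have k: "\<bar>1 / (2 * \<beta> + 2 * ?e)\<bar> \<le> 1 / (2 * \<beta>)"
    using assms by (simp add: divide_left_mono)
  have "(reg_coeff \<beta> t f g p)\<^sup>2
      \<le> (2 * (1 / (2 * \<beta>)))\<^sup>2 * ((inner f (\<phi> p))\<^sup>2 + (inner g (\<phi> p) / sqrt (lam p))\<^sup>2)"
    unfolding reg_coeff_def by (rule parallelogram_bound[OF k e])
  also have "\<dots> = ((inner f (\<phi> p))\<^sup>2 + (inner g (\<phi> p))\<^sup>2 / lam p) / \<beta>\<^sup>2"
    using lam_pos[of p] by (simp add: power_divide power_mult_distrib)
  also have "\<dots> \<le> ((inner f (\<phi> p))\<^sup>2 + (inner g (\<phi> p))\<^sup>2 / lam 0) / \<beta>\<^sup>2"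
    by (intro divide_right_mono add_left_mono divide_left_mono mult_pos_pos lam_0_le lam_pos) auto
  finally show ?thesis .
qed

lemma summable_data:
  "summable (\<lambda>p. ((inner f (\<phi> p))\<^sup>2 + (inner g (\<phi> p))\<^sup>2 / lam 0) / \<beta>\<^sup>2)"
  by (intro summable_divide summable_add summable_coeff_squared)

text \<open>Convergence for arbitrary data, so that the \<open>suminf\<close> in the definition is a
  genuine sum.\<close>

lemma regularized_solution_sums:
  assumes "0 < \<beta>" "\<beta> \<le> 1" "0 \<le> t"
  shows "(\<lambda>p. reg_coeff \<beta> t f g p *\<^sub>R \<phi> p) sums regularized_solution \<phi> lam \<beta> f g t"
proof -
  have "summable (\<lambda>p. (reg_coeff \<beta> t f g p)\<^sup>2)"
    by (rule summable_comparison_test'[OF summable_data[of f g \<beta>]])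
      (use reg_coeff_squared_le[OF assms] in auto)
  from summable_sums[OF summable_basis_series[OF this]] show ?thesis
    by (simp only: regularized_solution_def reg_coeff_def)
qed

text \<open>The coefficients are linear in the data, so the difference is the regularized series of
  the data error, to which the modewise majorant and Bessel apply.\<close>

lemma regularized_solution_noise:
  assumes "0 < \<beta>" "\<beta> \<le> 1" "0 \<le> t" "norm (f - f') \<le> \<epsilon>" "norm (g - g') \<le> \<epsilon>"
  shows "norm (regularized_solution \<phi> lam \<beta> f g t - regularized_solution \<phi> lam \<beta> f' g' t)
    \<le> sqrt (1 + 1 / lam 0) * (\<epsilon> / \<beta>)" (is "norm ?d \<le> _")
proof -
  let ?f = "\<lambda>p. (inner (f - f') (\<phi> p))\<^sup>2" and ?g = "\<lambda>p. (inner (g - g') (\<phi> p))\<^sup>2"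
  have \<epsilon>: "0 \<le> \<epsilon>" using assms(4) norm_ge_zero order_trans by blast
  have "(\<lambda>p. reg_coeff \<beta> t (f - f') (g - g') p *\<^sub>R \<phi> p) sums ?d"
    using sums_diff[OF regularized_solution_sums[OF assms(1-3), of f g]
        regularized_solution_sums[OF assms(1-3), of f' g']]
    by (simp only: reg_coeff_diff flip: scaleR_diff_left)
  from norm_basis_series_le[OF this summable_data reg_coeff_squared_le[OF assms(1-3)]]
  have "(norm ?d)\<^sup>2 \<le> (\<Sum>p. (?f p + ?g p / lam 0) / \<beta>\<^sup>2)" .
  also have "\<dots> = (suminf ?f + suminf ?g / lam 0) / \<beta>\<^sup>2"
    by (simp add: suminf_divide suminf_add[symmetric] summable_add summable_divide
        summable_coeff_squared)
  also have "\<dots> \<le> (\<epsilon>\<^sup>2 + \<epsilon>\<^sup>2 / lam 0) / \<beta>\<^sup>2"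
    using lam_0_pos assms(4,5)
    by (intro divide_right_mono add_mono order_trans[OF suminf_coeff_squared_le] power_mono) auto
  also have "\<dots> = (sqrt (1 + 1 / lam 0) * (\<epsilon> / \<beta>))\<^sup>2"
    using lam_0_pos by (simp add: power_mult_distrib power_divide field_simps)
  finally show ?thesis
    by (rule power2_le_imp_le) (use \<epsilon> assms(1) lam_0_pos in simp)
qed

text \<open>Splitting cosh and sinh into exponentials, the decaying parts coincide and cancel; only
  the multipliers of the growing part differ.\<close>

lemma mild_minus_reg_coeff:
  assumes "0 < \<beta>"
  shows "mild_coeff t f g p - reg_coeff \<beta> t f g p =
    growth_coeff f g p / 2 * (exp (sqrt (lam p) * t) * filter_error \<beta> (sqrt (lam p)) t)"
proof -
  define E where "E = exp (sqrt (lam p) * t)"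
  define F where "F = exp (- (sqrt (lam p) * t))"
  define b where "b = inner g (\<phi> p) / sqrt (lam p)"
  have E: "0 < F" "E * F = 1" by (simp_all add: E_def F_def flip: exp_add)
  then have nz: "\<beta> + F \<noteq> 0" using assms by linarith
  have mild: "mild_coeff t f g p = (E + F) / 2 * inner f (\<phi> p) + (E - F) / 2 * b"
    by (simp add: mild_coeff_def cosh_field_def sinh_field_def E_def F_def b_def)
  have reg: "reg_coeff \<beta> t f g p =
      1 / (\<beta> + F) / 2 * (inner f (\<phi> p) + b) + F / 2 * (inner f (\<phi> p) - b)"
    by (simp add: reg_coeff_def F_def b_def)
  have growth: "growth_coeff f g p = inner f (\<phi> p) + b"
    by (simp add: growth_coeff_def b_def)
  have "E * (\<beta> / (\<beta> + F)) = E - 1 / (\<beta> + F)"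
    using nz E(2) by (simp add: field_simps)
  then have filter: "exp (sqrt (lam p) * t) * filter_error \<beta> (sqrt (lam p)) t = E - 1 / (\<beta> + F)"
    by (simp add: filter_error_def E_def F_def)
  have "(E + F) / 2 * x + (E - F) / 2 * b - (k / 2 * (x + b) + F / 2 * (x - b))
      = (x + b) / 2 * (E - k)" for x k
    by (simp add: field_simps)
  then show ?thesis
    by (simp only: mild reg growth filter)
qed

text \<open>Triangle inequality through \<open>?w\<close>, the regularized solution for exact data.
  The sequence \<open>d\<close> is left free: each a priori bound supplies its own square-summable
  \<open>d\<close>, and \<open>K\<close> absorbs the damping.\<close>

lemma regularization_error:
  assumes \<beta>: "0 < \<beta>" "\<beta> \<le> 1" and t: "0 \<le> t"
    and noise: "norm (f - f') \<le> \<epsilon>" "norm (g - g') \<le> \<epsilon>"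
    and x: "(\<lambda>p. mild_coeff t f g p *\<^sub>R \<phi> p) sums x"
    and d: "summable (\<lambda>p. (d p)\<^sup>2)" "sqrt (\<Sum>p. (d p)\<^sup>2) \<le> E" and K: "0 \<le> K"
    and le: "\<And>p. \<bar>growth_coeff f g p\<bar> / 2 * (exp (sqrt (lam p) * t) * filter_error \<beta> (sqrt (lam p)) t)
      \<le> K * \<bar>d p\<bar>"
  shows "norm (x - regularized_solution \<phi> lam \<beta> f' g' t)
    \<le> sqrt (2 * (1 + 1 / lam 0)) * (\<epsilon> / \<beta>) + K * E"
proof -
  let ?w = "regularized_solution \<phi> lam \<beta> f g t"
  have \<epsilon>: "0 \<le> \<epsilon>" using noise(1) norm_ge_zero order_trans by blast
  have "(\<lambda>p. (mild_coeff t f g p - reg_coeff \<beta> t f g p) *\<^sub>R \<phi> p) sums (x - ?w)"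
    using sums_diff[OF x regularized_solution_sums[OF \<beta> t, of f g]]
    by (simp only: scaleR_diff_left)
  moreover have "summable (\<lambda>p. K\<^sup>2 * (d p)\<^sup>2)"
    by (intro summable_mult d)
  moreover have "(mild_coeff t f g p - reg_coeff \<beta> t f g p)\<^sup>2 \<le> K\<^sup>2 * (d p)\<^sup>2" for p
  proof -
    have "\<bar>mild_coeff t f g p - reg_coeff \<beta> t f g p\<bar> \<le> \<bar>K * d p\<bar>"
      using le[of p] K filter_error_nonneg[OF \<beta>(1), of "sqrt (lam p)" t]
      by (simp add: mild_minus_reg_coeff[OF \<beta>(1)] abs_mult)
    then show ?thesis
      using abs_le_square_iff by (metis power_mult_distrib)
  qed
  ultimately have "(norm (x - ?w))\<^sup>2 \<le> (\<Sum>p. K\<^sup>2 * (d p)\<^sup>2)"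
    by (rule norm_basis_series_le)
  also have "\<dots> = (K * sqrt (\<Sum>p. (d p)\<^sup>2))\<^sup>2"
    using d(1) by (simp add: suminf_mult power_mult_distrib suminf_nonneg)
  finally have "norm (x - ?w) \<le> K * sqrt (\<Sum>p. (d p)\<^sup>2)"
    by (rule power2_le_imp_le) (use K d(1) in \<open>simp add: suminf_nonneg\<close>)
  also have "\<dots> \<le> K * E" using d(2) K by (rule mult_left_mono)
  finally have 1: "norm (x - ?w) \<le> K * E" .
  \<comment> \<open>The noise estimate is sharper by a factor sqrt 2 than the constant claimed in
    the end.\<close>
  have "sqrt (1 + 1 / lam 0) * (\<epsilon> / \<beta>) \<le> sqrt (2 * (1 + 1 / lam 0)) * (\<epsilon> / \<beta>)"
    using lam_0_pos \<epsilon> \<beta> by (intro mult_right_mono real_sqrt_le_mono) (auto simp: field_simps)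
  then have 2: "norm (?w - regularized_solution \<phi> lam \<beta> f' g' t)
      \<le> sqrt (2 * (1 + 1 / lam 0)) * (\<epsilon> / \<beta>)"
    using regularized_solution_noise[OF \<beta> t noise] by linarith
  show ?thesis
    using norm_triangle_le[OF add_mono[OF 1 2]] by (simp add: add.commute)
qed

text \<open>The inner product with \<open>\<phi> p\<close> is bounded linear and so commutes with
  the derivative of \<open>u\<close>. The explicit scalar coefficient is then differentiated,
  without termwise differentiation of the series.\<close>

lemma mild_solution_derivative_coeff:
  assumes T: "0 < T" and t: "t \<in> {0..T}" and u: "mild_solution \<phi> lam T f g u"
    and u': "(u has_vector_derivative u't) (at t within {0..T})"
  shows "inner u't (\<phi> p) =
    sqrt (lam p) * sinh (sqrt (lam p) * t) * inner f (\<phi> p) + cosh (sqrt (lam p) * t) * inner g (\<phi> p)"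
proof -
  have coeff: "inner (u r) (\<phi> p) = mild_coeff r f g p" if "r \<in> {0..T}" for r
    using u that by (intro basis_series_coeff) (simp add: mild_solution_def mild_coeff_def)
  have "((\<lambda>r. inner (u r) (\<phi> p)) has_vector_derivative inner u't (\<phi> p)) (at t within {0..T})"
    by (rule bounded_linear.has_vector_derivative[OF bounded_linear_inner_left u'])
  then have *: "((\<lambda>r. mild_coeff r f g p) has_vector_derivative inner u't (\<phi> p)) (at t within {0..T})"
    by (rule has_vector_derivative_transform[OF t, rotated]) (simp add: coeff)
  have lin: "((\<lambda>r. sqrt (lam p) * r) has_real_derivative sqrt (lam p)) (at t within {0..T})"
    using DERIV_cmult[OF DERIV_ident, of "sqrt (lam p)"] by simp
  have "((\<lambda>r. mild_coeff r f g p) has_real_derivative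
      sinh (sqrt (lam p) * t) * sqrt (lam p) * inner f (\<phi> p)
      + cosh (sqrt (lam p) * t) * sqrt (lam p) / sqrt (lam p) * inner g (\<phi> p)) (at t within {0..T})"
    unfolding mild_coeff_def
    by (intro DERIV_add DERIV_cmult_right DERIV_cdivide has_field_derivative_cosh
        has_field_derivative_sinh lin)
  then have "((\<lambda>r. mild_coeff r f g p) has_vector_derivative
      sqrt (lam p) * sinh (sqrt (lam p) * t) * inner f (\<phi> p) + cosh (sqrt (lam p) * t) * inner g (\<phi> p))
      (at t within {0..T})"
    using lam_pos[of p]
    by (simp add: has_real_derivative_iff_has_vector_derivative mult.commute[of "sinh _"])
  \<comment> \<open>Derivatives within a nondegenerate interval are unique even at its
    endpoints.\<close>
  from vector_derivative_unique_within_closed_interval[of 0 T t, unfolded cbox_interval, OF T t * this]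
  show ?thesis .
qed

text \<open>Adding the two coefficients turns cosh and sinh into a single exponential; the decaying
  part drops out.\<close>

lemma mild_solution_growth:
  assumes T: "0 < T" and t: "t \<in> {0..T}" and u: "mild_solution \<phi> lam T f g u"
    and u': "(u has_vector_derivative u't) (at t within {0..T})"
  shows "sqrt (lam p) * inner (u t) (\<phi> p) + inner u't (\<phi> p)
    = sqrt (lam p) * growth_coeff f g p * exp (sqrt (lam p) * t)"
proof -
  have "inner (u t) (\<phi> p) = mild_coeff t f g p"
    using u t by (intro basis_series_coeff) (simp add: mild_solution_def mild_coeff_def)
  then show ?thesis
    using lam_pos[of p]
    by (simp add: mild_solution_derivative_coeff[OF assms] mild_coeff_def growth_coeff_def field_simps
        flip: cosh_plus_sinh)
qed

end

text \<open>\<open>u'\<close> is the derivative within [0, T], one-sided at the ends. The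
  \<open>summable\<close> conjuncts make each \<open>suminf\<close> meaningful. The premise
  \<open>1 \<le> lam 0\<close> lets \<open>lam 0\<close> replace its root in the logarithmic factor
  of (ii), and in (iii) supplies the factor \<open>sqrt (lam p)\<close> of the a priori sum. The
  positivity premise keeps the logarithmic denominator positive.\<close>

theorem theorem2:
  fixes D :: "'a::{real_inner, complete_space} set"
    and A :: "'a \<Rightarrow> 'a"
    and \<phi> :: "nat \<Rightarrow> 'a"
    and lam :: "nat \<Rightarrow> real"
    and T m \<epsilon> :: real
    and f g f\<epsilon> g\<epsilon> :: 'a
    and u u' v :: "real \<Rightarrow> 'a"
  assumes T: "0 < T"
    and A: "self_adjoint_operator D A" "positive_definite_operator D A" "has_compact_inverse D A"
    and basis: "eigenbasis D A \<phi> lam"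
    and m: "0 < m" "m < 1"
    and \<epsilon>: "0 < \<epsilon>" "\<epsilon> < 1"
    and u: "mild_solution \<phi> lam T f g u"
    and u': "\<And>t. t \<in> {0..T} \<Longrightarrow> (u has_vector_derivative u' t) (at t within {0..T})"
    and noise: "norm (f - f\<epsilon>) \<le> \<epsilon>" "norm (g - g\<epsilon>) \<le> \<epsilon>"
    and v: "v = regularized_solution \<phi> lam (\<epsilon> powr m) f\<epsilon> g\<epsilon>"
  shows
    "(\<forall>E1 > 0.
        sqrt ((norm (u T))\<^sup>2 / 2 + (norm (u' T))\<^sup>2 / (2 * lam 0)) < E1 \<longrightarrow>
        (\<forall>t\<in>{0..T/2}.
           norm (u t - v t)
             \<le> sqrt (2 * (1 + 1 / lam 0)) * \<epsilon> powr (1 - m) + E1 * \<epsilon> powr m) \<and>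
        (\<forall>t\<in>{T/2..T}.
           norm (u t - v t)
             \<le> sqrt (2 * (1 + 1 / lam 0)) * \<epsilon> powr (1 - m) + E1 * \<epsilon> powr (m * (T - t) / t)))
     \<and>
     (\<forall>E2 > 0.
        (\<forall>t\<in>{0..T}.
           summable (\<lambda>p. exp (2 * sqrt (lam p) * (T - t))
             * (sqrt (lam p) * inner (u t) (\<phi> p) + inner (u' t) (\<phi> p))\<^sup>2) \<and>
           sqrt (\<Sum>p. exp (2 * sqrt (lam p) * (T - t))
             * (sqrt (lam p) * inner (u t) (\<phi> p) + inner (u' t) (\<phi> p))\<^sup>2) < E2) \<longrightarrow>
        (\<forall>t\<in>{0..T/2}.
           norm (u t - v t)
             \<le> sqrt (2 * (1 + 1 / lam 0)) * \<epsilon> powr (1 - m)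
               + \<epsilon> powr m / (2 * sqrt (lam 0)) * E2) \<and>
        (1 \<le> lam 0 \<and> 0 < 1 + ln (sqrt (lam 0) * T / \<epsilon> powr m) \<longrightarrow>
         (\<forall>t\<in>{T/2..T}.
           norm (u t - v t)
             \<le> sqrt (2 * (1 + 1 / lam 0)) * \<epsilon> powr (1 - m)
               + \<epsilon> powr (m * (T - t) / t) / (2 * sqrt (lam 0))
                 * (lam 0 * T / (1 + ln (sqrt (lam 0) * T / \<epsilon> powr m))) powr ((2 * t - T) / t)
                 * E2)))
     \<and>
     (\<forall>E3 > 0.
        (\<forall>t\<in>{0..T}.
           summable (\<lambda>p. exp (2 * sqrt (lam p) * t)
             * (inner (sqrt (lam p) *\<^sub>R u t + u' t) (\<phi> p))\<^sup>2) \<and>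
           sqrt (\<Sum>p. exp (2 * sqrt (lam p) * t)
             * (inner (sqrt (lam p) *\<^sub>R u t + u' t) (\<phi> p))\<^sup>2) < E3) \<longrightarrow>
        (1 \<le> lam 0 \<longrightarrow>
         (\<forall>t\<in>{0..T}.
           norm (u t - v t)
             \<le> sqrt (2 * (1 + 1 / lam 0)) * \<epsilon> powr (1 - m) + E3 * (\<epsilon> powr m / 2))))"
proof -
  interpret eigen_sequence \<phi> lam
    using basis by unfold_locales (auto simp: eigenbasis_def orthonormal_basis_def)
  define \<beta> where "\<beta> = \<epsilon> powr m"
  have \<beta>: "0 < \<beta>" "\<beta> \<le> 1"
    using \<epsilon> m by (auto simp: \<beta>_def powr_le1)
  have \<epsilon>_div: "\<epsilon> / \<beta> = \<epsilon> powr (1 - m)"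
    using \<epsilon> by (simp add: \<beta>_def powr_diff)
  have \<beta>_powr: "\<beta> powr ((T - t) / t) = \<epsilon> powr (m * (T - t) / t)" for t
    by (simp add: \<beta>_def powr_powr)
  define s where "s p = sqrt (lam p)" for p
  define a where "a = growth_coeff f g"
  let ?C = "sqrt (2 * (1 + 1 / lam 0)) * \<epsilon> powr (1 - m)"
  let ?k = "\<lambda>t p. filter_error \<beta> (s p) t"
  have s_pos: "0 < s p" and s0_pos: "0 < s 0" and s0_le: "s 0 \<le> s p" and s_sq: "(s p)\<^sup>2 = lam p" for p
    using lam_pos[of p] lam_pos[of 0] lam_0_le[of p] by (auto simp: s_def)
  have k_nonneg: "0 \<le> ?k t p" for t p
    by (rule filter_error_nonneg[OF \<beta>(1)])
  have growth: "s p * inner (u t) (\<phi> p) + inner (u' t) (\<phi> p) = s p * a p * exp (s p * t)"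
    if "t \<in> {0..T}" for t p
    unfolding s_def a_def by (rule mild_solution_growth[OF T that u u'[OF that]])
  have error: "norm (u t - v t) \<le> ?C + K * E"
    if "t \<in> {0..T}" "summable (\<lambda>p. (d p)\<^sup>2)" "sqrt (\<Sum>p. (d p)\<^sup>2) \<le> E" "0 \<le> K"
      "\<And>p. \<bar>a p\<bar> / 2 * (exp (s p * t) * ?k t p) \<le> K * \<bar>d p\<bar>" for t d E K
  proof -
    have "(\<lambda>p. mild_coeff t f g p *\<^sub>R \<phi> p) sums u t"
      using u that(1) by (simp add: mild_solution_def mild_coeff_def)
    from regularization_error[OF \<beta> _ noise this that(2-4)] that(1,5) show ?thesis
      by (simp add: v \<epsilon>_div s_def a_def flip: \<beta>_def)
  qed
  \<comment> \<open>The bounds of (i) and (ii) control the growing part at the final time, so exp(s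
    t) is rewritten relative to exp(s T).\<close>
  have split_exp: "exp (s p * t) * x = exp (s p * T) * (exp (- (s p * (T - t))) * x)" for p t x
    by (simp add: algebra_simps flip: exp_add mult.assoc)
  have early: "exp (- (s p * (T - t))) * ?k t p \<le> \<beta>" if "t \<in> {0..T/2}" for t p
    using filter_error_early[of \<beta> "s p" t T] \<beta> s_pos[of p] that by simp
  have late: "exp (- (s p * (T - t))) * ?k t p \<le> \<beta> powr ((T - t) / t)" if "t \<in> {T/2..T}" for t p
  proof -
    have "0 \<le> (2 * t - T) / t" using that T by simp
    then have "?k t p powr ((2 * t - T) / t) \<le> 1"
      using k_nonneg[of p t] filter_error_le_1[OF \<beta>(1), of "s p" t] by (simp add: powr_le1)
    \<comment> \<open>With no spare factor 1 / s in (i), the leftover power of the damping is simply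
      bounded by 1.\<close>
    then have "\<beta> powr ((T - t) / t) * ?k t p powr ((2 * t - T) / t) \<le> \<beta> powr ((T - t) / t)"
      by (simp add: mult_left_le)
    with filter_error_late[of \<beta> T t "s p"] \<beta> T that show ?thesis
      by (meson atLeastAtMost_iff order_trans)
  qed

  have final_bound: "norm (u t - v t) \<le> ?C + K * E1"
    if E1: "sqrt ((norm (u T))\<^sup>2 / 2 + (norm (u' T))\<^sup>2 / (2 * lam 0)) < E1"
      and t: "t \<in> {0..T}" and K: "0 \<le> K" and le: "\<And>p. exp (- (s p * (T - t))) * ?k t p \<le> K"
    for E1 t K
  proof (rule error[OF t _ _ K])
    let ?d = "\<lambda>p. a p / 2 * exp (s p * T)"
    let ?U = "\<lambda>p. (inner (u T) (\<phi> p))\<^sup>2" and ?V = "\<lambda>p. (inner (u' T) (\<phi> p))\<^sup>2"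
    have d_le: "(?d p)\<^sup>2 \<le> ?U p / 2 + ?V p / (2 * lam 0)" for p
    proof -
      define x where "x = inner (u T) (\<phi> p)"
      define y where "y = inner (u' T) (\<phi> p) / s p"
      have "x + y = a p * exp (s p * T)"
        using growth[of T p] T s_pos[of p] by (simp add: x_def y_def field_simps)
      then have "(?d p)\<^sup>2 = ((x + y) / 2)\<^sup>2" by simp
      \<comment> \<open>Convexity of the square; this is the origin of the two halves in the bound
        on \<open>u T\<close> and \<open>u' T\<close>.\<close>
      also have "\<dots> \<le> x\<^sup>2 / 2 + y\<^sup>2 / 2"
        using zero_le_power2[of "x - y"] by (simp add: power2_eq_square field_simps)
      also have "y\<^sup>2 / 2 = ?V p / (2 * lam p)"
        by (simp add: y_def power_divide s_sq)
      also have "\<dots> \<le> ?V p / (2 * lam 0)"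
        using lam_0_le[of p] lam_0_pos lam_pos[of p] by (intro divide_left_mono) auto
      finally show ?thesis by (simp add: x_def)
    qed
    have sumUV: "summable (\<lambda>p. ?U p / 2 + ?V p / (2 * lam 0))"
      by (intro summable_add summable_divide summable_coeff_squared)
    show sumd: "summable (\<lambda>p. (?d p)\<^sup>2)"
      by (rule summable_comparison_test'[OF sumUV]) (use d_le in auto)
    have "(\<Sum>p. (?d p)\<^sup>2) \<le> (\<Sum>p. ?U p / 2 + ?V p / (2 * lam 0))"
      by (rule suminf_le[OF d_le sumd sumUV])
    also have "\<dots> = suminf ?U / 2 + suminf ?V / (2 * lam 0)"
      by (simp add: suminf_divide suminf_add[symmetric] summable_divide summable_coeff_squared)
    also have "\<dots> \<le> (norm (u T))\<^sup>2 / 2 + (norm (u' T))\<^sup>2 / (2 * lam 0)"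
      using lam_0_pos by (intro add_mono divide_right_mono suminf_coeff_squared_le) auto
    finally show "sqrt (\<Sum>p. (?d p)\<^sup>2) \<le> E1"
      using E1 by (meson less_imp_le order_trans real_sqrt_le_mono)
    show "\<bar>a p\<bar> / 2 * (exp (s p * t) * ?k t p) \<le> K * \<bar>?d p\<bar>" for p
      using mult_left_mono[OF le[of p], of "\<bar>a p\<bar> / 2 * exp (s p * T)"]
      unfolding split_exp[of p t] by (simp add: abs_mult mult_ac)
  qed

  have weighted_bound: "norm (u t - v t) \<le> ?C + K * E2"
    if E2: "\<forall>t\<in>{0..T}. summable (\<lambda>p. exp (2 * s p * (T - t))
             * (s p * inner (u t) (\<phi> p) + inner (u' t) (\<phi> p))\<^sup>2) \<and>
           sqrt (\<Sum>p. exp (2 * s p * (T - t))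
             * (s p * inner (u t) (\<phi> p) + inner (u' t) (\<phi> p))\<^sup>2) < E2"
      and t: "t \<in> {0..T}" and K: "0 \<le> K"
      and le: "\<And>p. exp (- (s p * (T - t))) * ?k t p / (2 * s p) \<le> K"
    for E2 t K
  proof (rule error[OF t _ _ K])
    \<comment> \<open>The weight exp(2 s (T - t)) moves the growing part from time \<open>t\<close>
      to time \<open>T\<close>, so this sequence does not depend on \<open>t\<close>. Its factor
      \<open>s p\<close> explains the division by \<open>2 * s p\<close> in the condition on
      \<open>K\<close>.\<close>
    let ?d = "\<lambda>p. s p * a p * exp (s p * T)"
    have "exp (2 * s p * (T - t)) * (s p * inner (u t) (\<phi> p) + inner (u' t) (\<phi> p))\<^sup>2 = (?d p)\<^sup>2" for p
    proof -
      have "exp (2 * s p * (T - t)) * (s p * a p * exp (s p * t))\<^sup>2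
          = (s p * a p * (exp (s p * (T - t)) * exp (s p * t)))\<^sup>2"
        by (simp add: power_mult_distrib mult.assoc flip: exp_double)
      also have "exp (s p * (T - t)) * exp (s p * t) = exp (s p * T)"
        by (simp add: algebra_simps flip: exp_add)
      finally show ?thesis by (simp add: growth[OF t])
    qed
    with E2[rule_format, OF t] show "summable (\<lambda>p. (?d p)\<^sup>2)" "sqrt (\<Sum>p. (?d p)\<^sup>2) \<le> E2"
      by (simp_all only: less_imp_le)
    show "\<bar>a p\<bar> / 2 * (exp (s p * t) * ?k t p) \<le> K * \<bar>?d p\<bar>" for p
    proof -
      have "\<bar>a p\<bar> / 2 * (exp (s p * t) * ?k t p)
          = \<bar>?d p\<bar> * (exp (- (s p * (T - t))) * ?k t p / (2 * s p))"
        using s_pos[of p] unfolding split_exp[of p t] by (simp add: abs_mult)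
      also have "\<dots> \<le> \<bar>?d p\<bar> * K" by (rule mult_left_mono[OF le]) simp
      finally show ?thesis by (simp add: mult.commute)
    qed
  qed

  have E1_part: "norm (u t - v t) \<le> ?C + E1 * \<epsilon> powr m" if "t \<in> {0..T/2}"
      "sqrt ((norm (u T))\<^sup>2 / 2 + (norm (u' T))\<^sup>2 / (2 * lam 0)) < E1" for t E1
    using final_bound[OF that(2), of t \<beta>] early that(1) T \<beta> by (simp add: \<beta>_def mult.commute)
  have E1_part': "norm (u t - v t) \<le> ?C + E1 * \<epsilon> powr (m * (T - t) / t)" if "t \<in> {T/2..T}"
      "sqrt ((norm (u T))\<^sup>2 / 2 + (norm (u' T))\<^sup>2 / (2 * lam 0)) < E1" for t E1
    using final_bound[OF that(2), of t "\<beta> powr ((T - t) / t)"] late that(1) T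
    by (simp add: \<beta>_powr mult.commute)

  have E2_part: "norm (u t - v t) \<le> ?C + \<epsilon> powr m / (2 * s 0) * E2"
    if t: "t \<in> {0..T/2}" and E2: "\<forall>t\<in>{0..T}. summable (\<lambda>p. exp (2 * s p * (T - t))
             * (s p * inner (u t) (\<phi> p) + inner (u' t) (\<phi> p))\<^sup>2) \<and>
           sqrt (\<Sum>p. exp (2 * s p * (T - t))
             * (s p * inner (u t) (\<phi> p) + inner (u' t) (\<phi> p))\<^sup>2) < E2" for t E2
    unfolding \<beta>_def[symmetric]
  proof (rule weighted_bound[OF E2])
    show "exp (- (s p * (T - t))) * ?k t p / (2 * s p) \<le> \<beta> / (2 * s 0)" for p
      using early[OF t, of p] s0_pos s0_le[of p] \<beta> by (intro frac_le) auto
  qed (use t T \<beta> s0_pos in auto)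
  have E2_part': "norm (u t - v t) \<le> ?C + \<epsilon> powr (m * (T - t) / t) / (2 * s 0)
                 * (lam 0 * T / (1 + ln (s 0 * T / \<epsilon> powr m))) powr ((2 * t - T) / t) * E2"
    if t: "t \<in> {T/2..T}" and E2: "\<forall>t\<in>{0..T}. summable (\<lambda>p. exp (2 * s p * (T - t))
             * (s p * inner (u t) (\<phi> p) + inner (u' t) (\<phi> p))\<^sup>2) \<and>
           sqrt (\<Sum>p. exp (2 * s p * (T - t))
             * (s p * inner (u t) (\<phi> p) + inner (u' t) (\<phi> p))\<^sup>2) < E2"
      and lam: "1 \<le> lam 0" and L: "0 < 1 + ln (s 0 * T / \<epsilon> powr m)" for t E2
    unfolding \<beta>_def[symmetric] \<beta>_powr[symmetric]
  proof (rule weighted_bound[OF E2])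
    show "exp (- (s p * (T - t))) * ?k t p / (2 * s p)
        \<le> \<beta> powr ((T - t) / t) / (2 * s 0) * (lam 0 * T / (1 + ln (s 0 * T / \<beta>))) powr ((2 * t - T) / t)"
      for p
      using filter_error_late_log[of \<beta> T t "s 0" "s p"] \<beta> T t lam L s0_le[of p]
      by (simp add: s_sq s_def[of 0] flip: \<beta>_def)
  qed (use t T \<beta> s0_pos in auto)

  have E3_part: "norm (u t - v t) \<le> ?C + E3 * (\<epsilon> powr m / 2)"
    if E3: "\<forall>t\<in>{0..T}. summable (\<lambda>p. exp (2 * s p * t) * (inner (s p *\<^sub>R u t + u' t) (\<phi> p))\<^sup>2) \<and>
           sqrt (\<Sum>p. exp (2 * s p * t) * (inner (s p *\<^sub>R u t + u' t) (\<phi> p))\<^sup>2) < E3"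
      and lam: "1 \<le> lam 0" and t: "t \<in> {0..T}" for E3 t
  proof -
    \<comment> \<open>One exponential comes from the growing part and one from the weight; the
      second matches the bound \<beta> exp(s t) on the damping, so no case distinction in
      \<open>t\<close> arises.\<close>
    let ?d = "\<lambda>p. s p * a p * (exp (s p * t) * exp (s p * t))"
    have "exp (2 * s p * t) * (inner (s p *\<^sub>R u t + u' t) (\<phi> p))\<^sup>2 = (?d p)\<^sup>2" for p
      using exp_double[of "s p * t"]
      by (simp add: inner_add_left growth[OF t] power_mult_distrib mult.assoc power2_eq_square)
    with E3[rule_format, OF t] have d: "summable (\<lambda>p. (?d p)\<^sup>2)" "sqrt (\<Sum>p. (?d p)\<^sup>2) \<le> E3"
      by (simp_all only: less_imp_le)
    have "norm (u t - v t) \<le> ?C + \<beta> / 2 * E3"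
    proof (rule error[OF t d])
      fix p
      have s1: "1 \<le> s p" using lam lam_0_le[of p] by (simp add: s_def)
      have "\<bar>a p\<bar> / 2 * (exp (s p * t) * ?k t p) \<le> \<bar>a p\<bar> / 2 * (exp (s p * t) * (\<beta> * exp (s p * t)))"
        by (intro mult_left_mono filter_error_le_exp \<beta>) auto
      also have "\<dots> = 1 * (\<beta> / 2 * (\<bar>a p\<bar> * (exp (s p * t) * exp (s p * t))))"
        by simp
      \<comment> \<open>The factor \<open>s p\<close> carried by \<open>?d\<close> is inserted at no
        cost because it is at least 1.\<close>
      also have "\<dots> \<le> s p * (\<beta> / 2 * (\<bar>a p\<bar> * (exp (s p * t) * exp (s p * t))))"
        using s1 \<beta> by (intro mult_right_mono) auto
      also have "\<dots> = \<beta> / 2 * \<bar>?d p\<bar>"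
        using s_pos[of p] by (simp add: abs_mult)
      finally show "\<bar>a p\<bar> / 2 * (exp (s p * t) * ?k t p) \<le> \<beta> / 2 * \<bar>?d p\<bar>" .
    qed (use \<beta> in simp)
    then show ?thesis by (simp add: \<beta>_def mult.commute)
  qed

  show ?thesis
    unfolding s_def[symmetric]
    by (intro conjI allI impI ballI; (elim conjE)?;
        rule E1_part E1_part' E2_part E2_part' E3_part; assumption)
qed

end
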